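(* Let $D\subset\mathbb{C}$ be a simply connected domain containing no zero of $1-14z^4+z^8$, fix a holomorphic branch of $\sqrt{1-14z^4+z^8}$ on $D$, and let $\lambda\in\mathbb{C}$, $\theta\in[0,\pi/2]$, $z_0\in D$. Put $$f_\theta(z)=\frac{e^{i\theta}}{\sqrt{1-14z^4+z^8}},\qquad g_1(z)=z,\qquad g_2(z)=\lambda z,$$ and let $X=(X_1,X_2,X_3,X_4):D\to\mathbb{R}^4$ be $$X(z)=\Re\int_{z_0}^z\Bigl(\tfrac12(1-g_1^2-g_2^2),\ \tfrac i2(1+g_1^2+g_2^2),\ g_1,\ g_2\Bigr)f_\theta\,dz.$$ If $\lambda=0$, then the image of $X$ lies in a $3$-dimensional affine subspace of $\mathbb{R}^4$, and $(X_1,X_2,X_3)$ is the member with angle $\theta$ of the classical associate family of the Schwarz P surface. More generally, if $\lambda\in\mathbb{R}$, then $X_4=\lambda X_3+\mathrm{constant}$, so the image of $X$ is contained in an affine $3$-dimensional subspace of $\mathbb{R}^4$. Consequently, $\operatorname{Im}\lambda\neq0$ is a necessary condition for the image of $X$ not to be contained in an affine $3$-dimensional subspace of $\mathbb{R}^4$.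
   Context: The classical associate (Bonnet) family of the Schwarz P surface is the family of minimal immersions into $\mathbb{R}^3$ given, up to an additive constant, by $z\mapsto\Re\int_{z_0}^z\bigl(\tfrac12(1-g^2),\tfrac i2(1+g^2),g\bigr)f_\theta\,dz$ with $g(z)=z$, $f_\theta(z)=e^{i\theta}/\sqrt{1-14z^4+z^8}$, $\theta\in[0,\pi/2]$ ($\theta=0$ is the P surface, $\theta=\pi/2$ the D surface). *)

theory Defs
  imports "HOL-Complex_Analysis.Complex_Analysis"
begin

definition schwarz_poly :: "complex \<Rightarrow> complex" where
  "schwarz_poly z = 1 - 14 * z ^ 4 + z ^ 8"

text \<open>The integral of \<open>h\<close> from \<open>z\<^sub>0\<close> to \<open>z\<close> inside \<open>D\<close>: the common value of the contour integrals
  along all paths in \<open>D\<close> joining the two points. It is meaningful for holomorphic \<open>h\<close> on a simply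
  connected domain, see \<open>path_integral_in_eq\<close> below.\<close>

definition path_integral_in :: "complex set \<Rightarrow> complex \<Rightarrow> (complex \<Rightarrow> complex) \<Rightarrow> complex \<Rightarrow> complex" where
  "path_integral_in D z0 h z =
     (THE I. \<forall>\<gamma>. valid_path \<gamma> \<and> path_image \<gamma> \<subseteq> D \<and> pathstart \<gamma> = z0 \<and> pathfinish \<gamma> = z
                \<longrightarrow> (h has_contour_integral I) \<gamma>)"

definition Re_path_integral ::
    "complex set \<Rightarrow> complex \<Rightarrow> (complex \<Rightarrow> complex ^ 'n) \<Rightarrow> complex \<Rightarrow> real ^ 'n" where
  "Re_path_integral D z0 \<Phi> z = (\<chi> j. Re (path_integral_in D z0 (\<lambda>w. \<Phi> w $ j) z))"

definition weierstrass_data3 ::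
    "(complex \<Rightarrow> complex) \<Rightarrow> (complex \<Rightarrow> complex) \<Rightarrow> complex \<Rightarrow> complex ^ 3" where
  "weierstrass_data3 g f z =
     vector [1 / 2 * (1 - (g z)\<^sup>2) * f z, \<i> / 2 * (1 + (g z)\<^sup>2) * f z, g z * f z]"

definition weierstrass_data4 ::
    "(complex \<Rightarrow> complex) \<Rightarrow> (complex \<Rightarrow> complex) \<Rightarrow> (complex \<Rightarrow> complex) \<Rightarrow> complex \<Rightarrow> complex ^ 4" where
  "weierstrass_data4 g1 g2 f z =
     vector [1 / 2 * (1 - (g1 z)\<^sup>2 - (g2 z)\<^sup>2) * f z, \<i> / 2 * (1 + (g1 z)\<^sup>2 + (g2 z)\<^sup>2) * f z,
             g1 z * f z, g2 z * f z]"

text \<open>Below, \<open>s\<close> is the chosen holomorphic branch of the square root of \<^const>\<open>schwarz_poly\<close>.\<close>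

definition schwarz_f :: "(complex \<Rightarrow> complex) \<Rightarrow> real \<Rightarrow> complex \<Rightarrow> complex" where
  "schwarz_f s \<theta> z = exp (\<i> * complex_of_real \<theta>) / s z"

definition schwarz_X ::
    "complex set \<Rightarrow> (complex \<Rightarrow> complex) \<Rightarrow> complex \<Rightarrow> complex \<Rightarrow> real \<Rightarrow> complex \<Rightarrow> real ^ 4" where
  "schwarz_X D s z0 l \<theta> =
     Re_path_integral D z0 (weierstrass_data4 (\<lambda>z. z) (\<lambda>z. l * z) (schwarz_f s \<theta>))"

text \<open>Members of the classical associate family are only determined up to an additive constant.\<close>

definition schwarz_P_associate ::
    "complex set \<Rightarrow> (complex \<Rightarrow> complex) \<Rightarrow> complex \<Rightarrow> real \<Rightarrow> (complex \<Rightarrow> real ^ 3) \<Rightarrow> bool" where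
  "schwarz_P_associate D s z0 \<theta> Y \<longleftrightarrow>
     (\<exists>c. \<forall>z\<in>D. Y z = Re_path_integral D z0 (weierstrass_data3 (\<lambda>z. z) (schwarz_f s \<theta>)) z + c)"

definition in_affine_3space :: "(real ^ 4) set \<Rightarrow> bool" where
  "in_affine_3space S \<longleftrightarrow> (\<exists>A. affine A \<and> aff_dim A = 3 \<and> S \<subseteq> A)"

lemma path_integral_in_eq:
  assumes D: "open D" "simply_connected D" and h: "h holomorphic_on D"
    and \<gamma>: "valid_path \<gamma>" "path_image \<gamma> \<subseteq> D" "pathstart \<gamma> = z0" "pathfinish \<gamma> = z"
  shows "(h has_contour_integral path_integral_in D z0 h z) \<gamma>"
proof -
  define I where "I = contour_integral \<gamma> h"
  have I: "(h has_contour_integral I) \<gamma>"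
    unfolding I_def using contour_integrable_holomorphic_simple[OF h D(1) \<gamma>(1,2)]
    by (rule has_contour_integral_integral)
  have all: "(h has_contour_integral I) p"
    if p: "valid_path p" "path_image p \<subseteq> D" "pathstart p = z0" "pathfinish p = z" for p
  proof -
    have pi: "(h has_contour_integral contour_integral p h) p"
      using contour_integrable_holomorphic_simple[OF h D(1) p(1,2)]
      by (rule has_contour_integral_integral)
    have loop: "(h has_contour_integral 0) (p +++ reversepath \<gamma>)"
      using D h p \<gamma> by (intro Cauchy_theorem_simply_connected[of D])
        (auto simp: path_image_join intro!: valid_path_join)
    have "(h has_contour_integral (contour_integral p h + - I)) (p +++ reversepath \<gamma>)"
      using pi I p \<gamma> by (intro has_contour_integral_join has_contour_integral_reversepath) auto
    then have "contour_integral p h + - I = 0"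
      using loop by (rule has_contour_integral_unique)
    then have "contour_integral p h = I" by simp
    then show ?thesis using pi by simp
  qed
  have "path_integral_in D z0 h z = I"
    unfolding path_integral_in_def
  proof (rule the_equality)
    fix J
    assume "\<forall>p. valid_path p \<and> path_image p \<subseteq> D \<and> pathstart p = z0 \<and> pathfinish p = z
      \<longrightarrow> (h has_contour_integral J) p"
    then show "J = I" using \<gamma> I contour_integral_unique by metis
  qed (use all in blast)
  then show ?thesis using I by simp
qed

end

theory Submission
  imports Defs
begin

text \<open>The fourth Weierstrass integrand is \<open>l\<close> times the third. A complex constant
  factors out of the path integral (\<open>path_integral_in_lmul\<close>), and a real one also
  commutes with Re, so for real \<open>l\<close> the surface satisfies X4 = \<open>l\<close> X3
  (\<open>schwarz_X_4_eq\<close>) and lies in a hyperplane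
  (\<open>in_affine_3space_if_linear_relation\<close>). For \<open>l = 0\<close> the first three
  integrands are the classical ones. The necessity of a nonzero imaginary part is the
  contrapositive.\<close>

lemma vector_4:
  fixes w x y z :: "'a::zero"
  shows "(vector [w, x, y, z] :: 'a ^ 4) $ 1 = w"
    and "(vector [w, x, y, z] :: 'a ^ 4) $ 2 = x"
    and "(vector [w, x, y, z] :: 'a ^ 4) $ 3 = y"
    and "(vector [w, x, y, z] :: 'a ^ 4) $ 4 = z"
  unfolding vector_def by simp_all

text \<open>The integral is a definite description over all paths, so both sides are evaluated along
  one common path in \<open>D\<close>, where contour integrals are unique.\<close>

lemma path_integral_in_lmul:
  assumes D: "open D" "connected D" "simply_connected D" and h: "h holomorphic_on D"
    and z: "z0 \<in> D" "z \<in> D"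
  shows "path_integral_in D z0 (\<lambda>w. c * h w) z = c * path_integral_in D z0 h z"
proof -
  obtain p where p: "polynomial_function p" "path_image p \<subseteq> D" "pathstart p = z0" "pathfinish p = z"
    using connected_open_polynomial_connected[OF D(1,2) z] by blast
  note p = valid_path_polynomial_function[OF p(1)] p(2-)
  have "((\<lambda>w. c * h w) has_contour_integral path_integral_in D z0 (\<lambda>w. c * h w) z) p"
    using D h p by (intro path_integral_in_eq holomorphic_intros)
  moreover have "((\<lambda>w. c * h w) has_contour_integral c * path_integral_in D z0 h z) p"
    using D h p by (intro has_contour_integral_lmul path_integral_in_eq)
  ultimately show ?thesis
    by (rule has_contour_integral_unique)
qed

lemma in_affine_3space_if_linear_relation:
  fixes S :: "(real ^ 4) set"
  assumes "\<And>x. x \<in> S \<Longrightarrow> x $ 4 = r * x $ 3"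
  shows "in_affine_3space S"
  unfolding in_affine_3space_def
proof (intro exI conjI)
  \<comment> \<open>This is the normal of the hyperplane x4 = r x3. Its fourth coordinate is 1 for
    every \<open>r\<close>, so it is nonzero and the hyperplane has dimension 3.\<close>
  define a :: "real ^ 4" where "a = axis 4 1 - r *\<^sub>R axis 3 1"
  have inner: "a \<bullet> x = x $ 4 - r * x $ 3" for x
    by (simp add: a_def inner_diff_left inner_axis')
  have "a $ 4 = 1"
    by (simp add: a_def axis_def)
  then have "a \<noteq> 0"
    by auto
  then show "aff_dim {x. a \<bullet> x = 0} = 3"
    by simp
  show "affine {x. a \<bullet> x = 0}"
    by (rule affine_hyperplane)
  show "S \<subseteq> {x. a \<bullet> x = 0}"
    using assms by (auto simp: inner)
qed

lemma schwarz_X_4_eq: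
  assumes D: "open D" "connected D" "simply_connected D"
    and s: "s holomorphic_on D" "\<And>w. w \<in> D \<Longrightarrow> s w \<noteq> 0"
    and z: "z0 \<in> D" "z \<in> D" and l: "l \<in> \<real>"
  shows "schwarz_X D s z0 l \<theta> z $ 4 = Re l * schwarz_X D s z0 l \<theta> z $ 3"
proof -
  have "(\<lambda>w. w * schwarz_f s \<theta> w) holomorphic_on D"
    unfolding schwarz_f_def by (intro holomorphic_intros s)
  \<comment> \<open>Realness of \<open>l\<close> enters here: Re (\<open>l\<close> I) =
    \<open>l\<close> Re I for the complex integral I.\<close>
  from path_integral_in_lmul[OF D this z, of l] l show ?thesis
    by (auto simp: schwarz_X_def Re_path_integral_def weierstrass_data4_def vector_4 mult.assoc
        elim: Reals_cases)
qed

text \<open>The term (0 z)^2 vanishes, so the integrands agree and the additive constant is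
  0.\<close>

lemma schwarz_P_associate_schwarz_X_0:
  "schwarz_P_associate D s z0 \<theta>
     (\<lambda>z. vector [schwarz_X D s z0 0 \<theta> z $ 1, schwarz_X D s z0 0 \<theta> z $ 2, schwarz_X D s z0 0 \<theta> z $ 3])"
  unfolding schwarz_P_associate_def
  by (rule exI[of _ 0])
    (simp add: schwarz_X_def Re_path_integral_def weierstrass_data4_def weierstrass_data3_def
      vec_eq_iff forall_3 vector_4)

theorem mainTheorem4:
  fixes D :: "complex set" and s :: "complex \<Rightarrow> complex"
    and l z0 :: complex and \<theta> :: real and X :: "complex \<Rightarrow> real ^ 4"
  assumes "open D" and "connected D" and "simply_connected D"
    and "\<forall>z\<in>D. schwarz_poly z \<noteq> 0"
    and "s holomorphic_on D" and "\<forall>z\<in>D. (s z)\<^sup>2 = schwarz_poly z"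
    and "\<theta> \<in> {0..pi / 2}" and "z0 \<in> D"
  defines "X \<equiv> schwarz_X D s z0 l \<theta>"
  shows "(l = 0 \<longrightarrow>
            in_affine_3space (X ` D) \<and>
            schwarz_P_associate D s z0 \<theta> (\<lambda>z. vector [X z $ 1, X z $ 2, X z $ 3])) \<and>
         (l \<in> \<real> \<longrightarrow>
            (\<exists>c. \<forall>z\<in>D. X z $ 4 = Re l * X z $ 3 + c) \<and>
            in_affine_3space (X ` D)) \<and>
         (\<not> in_affine_3space (X ` D) \<longrightarrow> Im l \<noteq> 0)"
proof -
  \<comment> \<open>A zero of \<open>s\<close> would be a zero of \<open>schwarz_poly\<close>; hence
    \<open>schwarz_f\<close> has no poles in \<open>D\<close>.\<close>
  have s: "s w \<noteq> 0" if "w \<in> D" for w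
    using assms(4,6) that by fastforce
  have rel: "\<forall>z\<in>D. X z $ 4 = Re l * X z $ 3" if "l \<in> \<real>"
    using schwarz_X_4_eq[OF assms(1-3,5) s assms(8) _ that] by (simp add: X_def)
  have aff: "in_affine_3space (X ` D)" if "l \<in> \<real>"
    using rel[OF that] by (intro in_affine_3space_if_linear_relation) auto
  have "\<exists>c. \<forall>z\<in>D. X z $ 4 = Re l * X z $ 3 + c" if "l \<in> \<real>"
    \<comment> \<open>The constant is 0 because all coordinates are integrated from the same base
      point \<open>z0\<close>.\<close>
    using rel[OF that] by (intro exI[of _ 0]) simp
  moreover have "schwarz_P_associate D s z0 \<theta> (\<lambda>z. vector [X z $ 1, X z $ 2, X z $ 3])" if "l = 0"
    unfolding X_def that by (rule schwarz_P_associate_schwarz_X_0)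
  ultimately show ?thesis
    using aff by (auto simp: complex_is_Real_iff)
qed

end
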